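(* The map $\mathscr{R}:\mathcal{E}(r_1,\dots,r_m)\to\mathcal{E}(r_1,\dots,r_m)$ is onto; that is, for every $\widetilde{Q}\in\mathcal{E}(r_1,\dots,r_m)$ there exists $\widetilde{P}\in\mathcal{E}(r_1,\dots,r_m)$ with $\mathscr{R}(\widetilde{P})=\widetilde{Q}$.
   Context: Setting: $\mathcal{H}$ is a complex Hilbert space of finite dimension $n$; $r_1\ge r_2\ge\dots\ge r_m\ge 1$ are integers with $\sum_{i=1}^m r_i=n$. $\mathcal{E}(r_1,\dots,r_m)$ is the set of (ordered) ensembles $\{p_i,\rho_i\}_{i=1}^m$ with $p_i>0$, $\sum_i p_i=1$, $\rho_i$ density operators on $\mathcal{H}$ with $\mathrm{rank}(\rho_i)=r_i$, and supports $\mathrm{supp}(\rho_1),\dots,\mathrm{supp}(\rho_m)$ linearly independent and together spanning $\mathcal{H}$. An $m$-element POVM is a family $\{\Pi_i\}_{i=1}^m$ with $\Pi_i\ge 0$, $\sum_i\Pi_i=\mathbb{1}$; it is optimal for minimum error discrimination (MED) of $\{p_i,\rho_i\}$ if it maximizes $\sum_i p_i\mathrm{Tr}(\rho_i\Pi_i)$ over all $m$-element POVMs. Known fact: for an ensemble in $\mathcal{E}(r_1,\dots,r_m)$ the optimal POVM is unique and is a projective measurement with $\mathrm{rank}(\Pi_i)=r_i$. Definition of $\mathscr{R}$: given $\widetilde{P}=\{p_i,\rho_i\}\in\mathcal{E}(r_1,\dots,r_m)$ with optimal POVM $\{\Pi_i\}$, choose a decomposition $p_i\rho_i=\sum_{j=1}^{r_i}|\widetilde{\psi}_{ij}\rangle\langle\widetilde{\psi}_{ij}|$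 into unnormalized pure states for each $i$, and an orthonormal basis $\{|w_{ij}\rangle\}_{j=1}^{r_i}$ of $\mathrm{supp}(\Pi_i)$ such that the $r_i\times r_i$ matrix $(X^{(ii)})_{jk}=\langle\widetilde{\psi}_{ij}|w_{ik}\rangle$ is positive semidefinite (it is then positive definite). Put $|\widetilde{\chi}_{ij}\rangle=\sum_{k=1}^{r_i}(X^{(ii)})_{kj}|\widetilde{\psi}_{ik}\rangle$ and $$\sigma_i=\frac{\sum_{j=1}^{r_i}|\widetilde{\chi}_{ij}\rangle\langle\widetilde{\chi}_{ij}|}{\sum_{k=1}^{r_i}\langle\widetilde{\chi}_{ik}|\widetilde{\chi}_{ik}\rangle},\qquad q_i=\frac{\sum_{j=1}^{r_i}\langle\widetilde{\chi}_{ij}|\widetilde{\chi}_{ij}\rangle}{\sum_{l=1}^m\sum_{k=1}^{r_l}\langle\widetilde{\chi}_{lk}|\widetilde{\chi}_{lk}\rangle}.$$ Then $\mathscr{R}(\widetilde{P})=\{q_i,\sigma_i\}_{i=1}^m$. The result does not depend on the choices and lies in $\mathcal{E}(r_1,\dots,r_m)$, with $\mathrm{supp}(\sigma_i)=\mathrm{supp}(\rho_i)$. *)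

theory Defs
  imports "HOL-Analysis.Analysis"
begin

text \<open>
  The Hilbert space of dimension \<open>n\<close> is \<open>complex ^ 'n\<close> with \<open>n = CARD('n)\<close>, operators are
  complex square matrices, and the inner product is conjugate-linear in its first argument.
  (The library's \<open>inner\<close> on this type is only the real part of it.)
  All index ranges start at \<open>0\<close> instead of \<open>1\<close>.
\<close>

definition cinner :: "complex ^ 'n \<Rightarrow> complex ^ 'n \<Rightarrow> complex"
  where "cinner x y = (\<Sum>a\<in>UNIV. cnj (x $ a) * y $ a)"

definition ketbra :: "complex ^ 'n \<Rightarrow> complex ^ 'n \<Rightarrow> complex ^ 'n ^ 'n"
  where "ketbra x y = (\<chi> a b. x $ a * cnj (y $ b))"

text \<open>
  Positive semidefiniteness of a matrix with index set \<open>I\<close>. Over the complex numbers,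
  reality of the quadratic form already makes the matrix Hermitian.
\<close>

definition psd_on :: "'i set \<Rightarrow> ('i \<Rightarrow> 'i \<Rightarrow> complex) \<Rightarrow> bool"
  where "psd_on I M \<longleftrightarrow> (\<forall>c. (\<Sum>a\<in>I. \<Sum>b\<in>I. cnj (c a) * M a b * c b) \<in> \<real>\<^sub>\<ge>\<^sub>0)"

definition psd :: "complex ^ 'n ^ 'n \<Rightarrow> bool"
  where "psd A \<longleftrightarrow> psd_on UNIV (\<lambda>a b. A $ a $ b)"

definition density_operator :: "complex ^ 'n ^ 'n \<Rightarrow> bool"
  where "density_operator A \<longleftrightarrow> psd A \<and> trace A = 1"

text \<open>The support is the orthogonal complement of the kernel.\<close>

definition supp :: "complex ^ 'n ^ 'n \<Rightarrow> (complex ^ 'n) set"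
  where "supp A = {x. \<forall>y. A *v y = 0 \<longrightarrow> cinner y x = 0}"

text \<open>An ensemble is the list of the pairs \<open>(p\<^sub>i, \<rho>\<^sub>i)\<close>.\<close>

type_synonym 'n ensemble = "(real \<times> (complex ^ 'n ^ 'n)) list"

abbreviation prob :: "'n ensemble \<Rightarrow> nat \<Rightarrow> real"
  where "prob P i \<equiv> fst (P ! i)"

abbreviation state :: "'n ensemble \<Rightarrow> nat \<Rightarrow> complex ^ 'n ^ 'n"
  where "state P i \<equiv> snd (P ! i)"

definition independent_subspaces :: "nat \<Rightarrow> (nat \<Rightarrow> (complex ^ 'n) set) \<Rightarrow> bool"
  where "independent_subspaces m V \<longleftrightarrow>
    (\<forall>v. (\<forall>i<m. v i \<in> V i) \<and> (\<Sum>i<m. v i) = 0 \<longrightarrow> (\<forall>i<m. v i = 0))"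

definition ensembles :: "nat list \<Rightarrow> 'n::finite ensemble set"
  where "ensembles r = {P. length P = length r \<and>
    (\<forall>i<length r. prob P i > 0) \<and>
    (\<Sum>i<length r. prob P i) = 1 \<and>
    (\<forall>i<length r. density_operator (state P i) \<and> rank (state P i) = r ! i) \<and>
    independent_subspaces (length r) (\<lambda>i. supp (state P i)) \<and>
    vec.span (\<Union>i<length r. supp (state P i)) = UNIV}"

definition povm :: "nat \<Rightarrow> (complex ^ 'n ^ 'n) list \<Rightarrow> bool"
  where "povm m E \<longleftrightarrow> length E = m \<and> (\<forall>i<m. psd (E ! i)) \<and> (\<Sum>i<m. E ! i) = mat 1"

text \<open>The traces below are real, being traces of products of positive semidefinite matrices.\<close>

definition success_prob :: "'n ensemble \<Rightarrow> (complex ^ 'n ^ 'n) list \<Rightarrow> real"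
  where "success_prob P E = (\<Sum>i<length P. prob P i * Re (trace (state P i ** E ! i)))"

definition optimal_povm :: "'n ensemble \<Rightarrow> (complex ^ 'n ^ 'n) list \<Rightarrow> bool"
  where "optimal_povm P E \<longleftrightarrow> povm (length P) E \<and>
    (\<forall>F. povm (length P) F \<longrightarrow> success_prob P F \<le> success_prob P E)"

definition orthonormal_basis_of :: "nat \<Rightarrow> (nat \<Rightarrow> complex ^ 'n) \<Rightarrow> (complex ^ 'n) set \<Rightarrow> bool"
  where "orthonormal_basis_of d w V \<longleftrightarrow>
    (\<forall>j<d. \<forall>k<d. cinner (w j) (w k) = (if j = k then 1 else 0)) \<and>
    vec.span (w ` {..<d}) = V"

definition X_block ::
    "(nat \<Rightarrow> nat \<Rightarrow> complex ^ 'n) \<Rightarrow> (nat \<Rightarrow> nat \<Rightarrow> complex ^ 'n) \<Rightarrow> nat \<Rightarrow> nat \<Rightarrow> nat \<Rightarrow> complex"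
  where "X_block \<psi> w i j k = cinner (\<psi> i j) (w i k)"

definition admissible_choice ::
    "nat list \<Rightarrow> 'n::finite ensemble \<Rightarrow> (complex ^ 'n ^ 'n) list \<Rightarrow>
      (nat \<Rightarrow> nat \<Rightarrow> complex ^ 'n) \<Rightarrow> (nat \<Rightarrow> nat \<Rightarrow> complex ^ 'n) \<Rightarrow> bool"
  where "admissible_choice r P E \<psi> w \<longleftrightarrow> optimal_povm P E \<and>
    (\<forall>i<length r.
      prob P i *\<^sub>R state P i = (\<Sum>j<r ! i. ketbra (\<psi> i j) (\<psi> i j)) \<and>
      orthonormal_basis_of (r ! i) (w i) (supp (E ! i)) \<and>
      psd_on {..<r ! i} (X_block \<psi> w i))"

definition chi_vec ::
    "nat list \<Rightarrow> (nat \<Rightarrow> nat \<Rightarrow> complex ^ 'n) \<Rightarrow> (nat \<Rightarrow> nat \<Rightarrow> complex ^ 'n) \<Rightarrow>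
      nat \<Rightarrow> nat \<Rightarrow> complex ^ 'n"
  where "chi_vec r \<psi> w i j = (\<Sum>k<r ! i. X_block \<psi> w i k j *s \<psi> i k)"

definition chi_weight ::
    "nat list \<Rightarrow> (nat \<Rightarrow> nat \<Rightarrow> complex ^ 'n) \<Rightarrow> (nat \<Rightarrow> nat \<Rightarrow> complex ^ 'n) \<Rightarrow> nat \<Rightarrow> real"
  where "chi_weight r \<psi> w i =
    (\<Sum>j<r ! i. Re (cinner (chi_vec r \<psi> w i j) (chi_vec r \<psi> w i j)))"

definition chi_ensemble ::
    "nat list \<Rightarrow> (nat \<Rightarrow> nat \<Rightarrow> complex ^ 'n) \<Rightarrow> (nat \<Rightarrow> nat \<Rightarrow> complex ^ 'n) \<Rightarrow> 'n ensemble"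
  where "chi_ensemble r \<psi> w = map (\<lambda>i.
    (chi_weight r \<psi> w i / (\<Sum>l<length r. chi_weight r \<psi> w l),
     (1 / chi_weight r \<psi> w i) *\<^sub>R
       (\<Sum>j<r ! i. ketbra (chi_vec r \<psi> w i j) (chi_vec r \<psi> w i j)))) [0..<length r]"

text \<open>
  The map \<open>\<R>\<close>. The definite description encodes that the value does not depend on the
  choices of \<open>\<psi>\<close> and \<open>w\<close>: an equation \<open>R_map r P = Q\<close> is derived by showing that admissible
  choices exist and that all of them produce \<open>Q\<close>.
\<close>

definition R_map :: "nat list \<Rightarrow> 'n::finite ensemble \<Rightarrow> 'n ensemble"
  where "R_map r P = (THE Q. \<exists>E \<psi> w. admissible_choice r P E \<psi> w \<and> Q = chi_ensemble r \<psi> w)"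

end

(*
  Write S = sum_i q_i sigma_i and Z = S^(1/2). As the supports are independent and span the space, the
  operators Pi_i = Z^(-1) q_i sigma_i Z^(-1) are mutually orthogonal projections with sum 1 (the pretty
  good measurement of Q). Put p_i rho_i = c Z Pi_i (Pi_i Z Pi_i)^+ Pi_i Z. Then p_i rho_i Pi_i = c Z Pi_i
  and p_i rho_i <= c Z, so c Z is a dual certificate and {Pi_i} is the only optimal POVM of P. For every
  admissible choice, sum_j |chi_ij><chi_ij| = (p_i rho_i) Pi_i (p_i rho_i) = c^2 Z Pi_i Z = c^2 q_i sigma_i,
  which gives R(P) = Q. Concretely, an orthonormal basis w_ij of the range of Pi_i that diagonalises
  Pi_i Z Pi_i, with eigenvalues Lambda_ij, gives the vectors Z w_ij / sqrt Lambda_ij, for which the block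
  X^(ii) is diagonal and positive.
*)
theory Submission
  imports Defs
begin

section \<open>The complex inner product and positive semidefinite matrices\<close>

text \<open>The choice of \<open>Z\<close> is forced. If {Pi_i} is optimal for P and K = sum_i p_i
  rho_i Pi_i is the dual operator, then p_i rho_i Pi_i = K Pi_i, so R sends p_i rho_i to K Pi_i K up
  to one common factor, and these images sum to K^2. So R(P) = Q is possible only if K is
  proportional to S^(1/2), and Q then fixes the Pi_i. Given K and Pi_i, block matrices relative to
  Pi_i show that only one positive semidefinite operator of rank r_i agrees with K after right
  multiplication by Pi_i: the one used for p_i rho_i. What is left over from K is a Schur
  complement, hence positive semidefinite, and this is the dual inequality. The constant c is 1 /
  \<open>\<nu>\<close>, the factor that normalises the total trace. Since \<open>R_map\<close> is a
  definite description ranging over all optimal POVMs, decompositions and bases, one good choice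
  does not determine its value. Uniqueness of the optimal POVM therefore has to be extracted from
  the certificate itself.\<close>

lemma cinner_add_left: "cinner (x + y) z = cinner x z + cinner y z"
  by (simp add: cinner_def algebra_simps sum.distrib)

lemma cinner_add_right: "cinner x (y + z) = cinner x y + cinner x z"
  by (simp add: cinner_def algebra_simps sum.distrib)

lemma cinner_diff_left: "cinner (x - y) z = cinner x z - cinner y z"
  by (simp add: cinner_def algebra_simps sum_subtractf)

lemma cinner_diff_right: "cinner x (y - z) = cinner x y - cinner x z"
  by (simp add: cinner_def algebra_simps sum_subtractf)

lemma cinner_scale_left [simp]: "cinner (c *s x) y = cnj c * cinner x y"
  by (simp add: cinner_def algebra_simps sum_distrib_left)

lemma cinner_scale_right [simp]: "cinner x (c *s y) = c * cinner x y"
  by (simp add: cinner_def algebra_simps sum_distrib_left)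

lemma cinner_zero_left [simp]: "cinner 0 x = 0"
  by (simp add: cinner_def)

lemma cinner_zero_right [simp]: "cinner x 0 = 0"
  by (simp add: cinner_def)

lemma cinner_sum_right: "cinner x (\<Sum>i\<in>I. f i) = (\<Sum>i\<in>I. cinner x (f i))"
  by (induction I rule: infinite_finite_induct) (simp_all add: cinner_add_right)

lemma cnj_cinner: "cnj (cinner x y) = cinner y x"
  by (simp add: cinner_def mult.commute)

lemma cinner_self: "cinner x x = of_real ((norm x)\<^sup>2)"
proof -
  have "cinner x x = (\<Sum>a\<in>UNIV. of_real ((norm (x $ a))\<^sup>2))"
    unfolding cinner_def
    by (intro sum.cong refl) (metis complex_norm_square mult.commute of_real_power)
  also have "\<dots> = of_real ((norm x)\<^sup>2)"
    by (simp add: norm_vec_def L2_set_def sum_nonneg)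
  finally show ?thesis .
qed

lemma cinner_self_eq_0_iff [simp]: "cinner x x = 0 \<longleftrightarrow> x = 0"
  by (simp add: cinner_self)

lemma cinner_left_eq_0: "(\<And>y. cinner y x = 0) \<Longrightarrow> x = 0"
  using cinner_self_eq_0_iff by blast

lemma cinner_eqI: "(\<And>y. cinner y x = cinner y z) \<Longrightarrow> x = z"
  using cinner_left_eq_0[of "x - z"] by (simp add: cinner_diff_right)

lemma scaleR_eq_scale: "c *\<^sub>R x = complex_of_real c *s (x :: complex ^ 'n)"
  by (simp add: vec_eq_iff scaleR_conv_of_real[where ?'a = complex])

lemma scaleR_mult_vec: "(c *\<^sub>R A) *v x = complex_of_real c *s (A *v (x :: complex ^ 'n))"
  by (simp add: vec_eq_iff matrix_vector_mult_def scaleR_conv_of_real[where ?'a = complex] sum_distrib_left algebra_simps)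

lemma sum_mult_vec: "(\<Sum>i\<in>I. A i) *v x = (\<Sum>i\<in>I. A i *v (x :: complex ^ 'n))"
  by (induction I rule: infinite_finite_induct) (simp_all add: matrix_vector_mult_add_rdistrib)

lemma mult_vec_sum: "A *v (\<Sum>i\<in>I. f i) = (\<Sum>i\<in>I. A *v (f i :: complex ^ 'n))"
  by (induction I rule: infinite_finite_induct) (simp_all add: matrix_vector_right_distrib)

lemma mult_vec_scale: "A *v (c *s x) = c *s (A *v (x :: complex ^ 'n))"
  by (simp add: vector_scalar_commute)

lemma ketbra_mult_vec: "ketbra x y *v z = cinner y z *s x"
  by (simp add: vec_eq_iff ketbra_def matrix_vector_mult_def cinner_def sum_distrib_left sum_distrib_right algebra_simps)

lemma trace_scaleR: "trace (c *\<^sub>R A) = complex_of_real c * trace A"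
  by (simp add: trace_def scaleR_conv_of_real[where ?'a = complex] sum_distrib_left)

lemma trace_ketbra: "trace (ketbra x y) = cinner y x"
  by (simp add: trace_def ketbra_def cinner_def mult.commute)

lemma trace_mult_ketbra: "trace (A ** ketbra x y) = cinner y (A *v x)"
  by (simp add: trace_def ketbra_def cinner_def matrix_matrix_mult_def matrix_vector_mult_def
      sum_distrib_left sum_distrib_right algebra_simps)

lemma trace_sum: "trace (\<Sum>i\<in>I. A i) = (\<Sum>i\<in>I. trace (A i))"
  by (induction I rule: infinite_finite_induct) (simp_all add: trace_def sum.distrib)

lemma matrix_mul_sum: "A ** (\<Sum>i\<in>I. B i :: complex ^ 'n ^ 'n) = (\<Sum>i\<in>I. A ** B i)"
  by (simp add: matrix_eq sum_mult_vec mult_vec_sum flip: matrix_vector_mul_assoc)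

lemma psd_iff_cinner: "psd A \<longleftrightarrow> (\<forall>x. cinner x (A *v x) \<in> \<real>\<^sub>\<ge>\<^sub>0)"
proof -
  have *: "(\<Sum>a\<in>UNIV. \<Sum>b\<in>UNIV. cnj (c a) * A $ a $ b * c b) = cinner (\<chi> a. c a) (A *v (\<chi> a. c a))" for c
    by (simp add: cinner_def matrix_vector_mult_def sum_distrib_left algebra_simps)
  show ?thesis
    unfolding psd_def psd_on_def * by (metis vec_nth_inverse)
qed

lemma psd_cinner: "psd A \<Longrightarrow> cinner x (A *v x) = of_real (Re (cinner x (A *v x)))"
  by (simp add: complex_eq_iff complex_nonneg_Reals_iff psd_iff_cinner)

lemma psd_Re_nonneg: "psd A \<Longrightarrow> Re (cinner x (A *v x)) \<ge> 0"
  by (simp add: complex_nonneg_Reals_iff psd_iff_cinner)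

text \<open>Polarisation: the form is real at \<open>x + y\<close> and at \<open>x + \<i>y\<close>.\<close>

lemma psd_selfadjoint:
  assumes "psd A"
  shows "cinner x (A *v y) = cinner (A *v x) y"
proof -
  have real: "Im (cinner z (A *v z)) = 0" for z
    using assms by (simp add: complex_nonneg_Reals_iff psd_iff_cinner)
  have "Im (cinner x (A *v y) + cinner y (A *v x)) = 0"
    using real[of "x + y"] real[of x] real[of y]
    by (simp add: matrix_vector_right_distrib cinner_add_left cinner_add_right)
  moreover have "Im (\<i> * cinner x (A *v y) - \<i> * cinner y (A *v x)) = 0"
    using real[of "x + \<i> *s y"] real[of x] real[of y]
    by (simp add: matrix_vector_right_distrib cinner_add_left cinner_add_right mult_vec_scale)
  ultimately have "cinner x (A *v y) = cnj (cinner y (A *v x))"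
    by (simp add: complex_eq_iff)
  then show ?thesis
    by (simp add: cnj_cinner)
qed

text \<open>Such an \<open>x\<close> minimises the form on \<open>V\<close>, so its first variation
  in every direction of \<open>V\<close> vanishes. Nonnegativity is asked on \<open>V\<close> only,
  because the diagonalisation below applies this to a form controlled just on a subspace.\<close>

lemma psd_form_zero:
  assumes V: "vec.subspace V"
    and sa: "\<And>x y. cinner x (A *v y) = cinner (A *v x) y"
    and nonneg: "\<And>z. z \<in> V \<Longrightarrow> Re (cinner z (A *v z)) \<ge> 0"
    and x: "x \<in> V" "Re (cinner x (A *v x)) = 0" and y: "y \<in> V"
  shows "cinner y (A *v x) = 0"
proof (rule ccontr)
  define a where "a = cinner y (A *v x)"
  define b where "b = Re (cinner y (A *v y))"
  assume "cinner y (A *v x) \<noteq> 0"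
  then have a: "(cmod a)\<^sup>2 > 0" by (simp add: a_def)
  have b: "b \<ge> 0" using nonneg y by (simp add: b_def)
  have quad: "2 * t * (cmod a)\<^sup>2 + t\<^sup>2 * (cmod a)\<^sup>2 * b \<ge> 0" for t :: real
  proof -
    \<comment> \<open>The phase of \<open>a\<close> turns the linear term into the real number 2 t
      |a|^2, whose sign is that of \<open>t\<close>.\<close>
    define z where "z = x + (of_real t * a) *s y"
    have "z \<in> V" unfolding z_def using V x y by (simp add: vec.subspace_add vec.subspace_scale)
    then have "Re (cinner z (A *v z)) \<ge> 0" by (rule nonneg)
    moreover have "cinner x (A *v y) = cnj a"
      by (simp add: a_def cnj_cinner sa)
    then have "cinner z (A *v z) = cinner x (A *v x) + of_real (2 * t) * (a * cnj a)
        + of_real (t\<^sup>2) * (a * cnj a) * cinner y (A *v y)"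
      by (simp add: z_def matrix_vector_right_distrib cinner_add_left cinner_add_right mult_vec_scale
          a_def[symmetric] algebra_simps power2_eq_square)
    then have "Re (cinner z (A *v z)) = 2 * t * (cmod a)\<^sup>2 + t\<^sup>2 * (cmod a)\<^sup>2 * b"
      using x(2) unfolding complex_norm_square[symmetric] b_def by (simp flip: of_real_power)
    ultimately show ?thesis by simp
  qed
  \<comment> \<open>Negative, yet with |t| b < 1, so that the quadratic term cannot outweigh the
    linear one.\<close>
  define t where "t = - 1 / (b + 1)"
  have "2 * t * (cmod a)\<^sup>2 + t\<^sup>2 * (cmod a)\<^sup>2 * b = (cmod a)\<^sup>2 * (t * (2 + t * b))"
    by (simp add: algebra_simps power2_eq_square)
  moreover have "t < 0" "2 + t * b > 0" using b by (auto simp: t_def field_simps)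
  ultimately show False using quad[of t] a
    by (simp add: mult_less_0_iff zero_le_mult_iff)
qed

lemma psd_form_zero_imp:
  assumes "psd A" "cinner x (A *v x) = 0"
  shows "A *v x = 0"
proof (rule cinner_left_eq_0)
  show "cinner y (A *v x) = 0" for y
    using psd_form_zero[OF vec.subspace_UNIV psd_selfadjoint[OF assms(1)] psd_Re_nonneg[OF assms(1)], of x y]
      assms(2) by simp
qed

section \<open>Orthonormal bases diagonalising a Hermitian form on a subspace\<close>

lemma subspace_of_complex: "vec.subspace V \<Longrightarrow> subspace (V :: (complex ^ 'n) set)"
  by (simp add: subspace_def vec.subspace_def scaleR_eq_scale)

text \<open>A unit vector maximising the form on \<open>V\<close> splits off, and one continues in its complement.\<close>

lemma orthonormal_form_diagonalising_basis:
  fixes A :: "complex ^ 'n ^ 'n"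
  assumes sa: "\<And>x y. cinner x (A *v y) = cinner (A *v x) y"
    and "vec.subspace V"
  shows "\<exists>w. orthonormal_basis_of (vec.dim V) w V \<and>
    (\<forall>j<vec.dim V. \<forall>k<vec.dim V. j \<noteq> k \<longrightarrow> cinner (w j) (A *v w k) = 0)"
  using \<open>vec.subspace V\<close>
proof (induction "vec.dim V" arbitrary: V)
  case 0
  then have "V = {0}" using vec.dim_eq_0[of V] vec.subspace_0 by auto
  with 0 show ?case by (simp add: orthonormal_basis_of_def vec.span_empty)
next
  case (Suc d)
  note V = Suc.prems
  define S where "S = {x \<in> V. norm x = 1}"
  have "V \<noteq> {0}" using Suc.hyps(2) by force
  then obtain v where v: "v \<in> V" "v \<noteq> 0" using vec.subspace_0[OF V] by blast
  have unit: "(1 / norm z) *\<^sub>R z \<in> S" if "z \<in> V" "z \<noteq> 0" for z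
    using that subspace_of_complex[OF V] by (simp add: S_def subspace_scale)
  have "S = V \<inter> sphere 0 1" by (auto simp: S_def)
  then have "compact S"
    using closed_subspace[OF subspace_of_complex[OF V]] by (simp add: closed_Int_compact)
  moreover have "S \<noteq> {}" using unit v by blast
  moreover have "continuous_on S (\<lambda>z. Re (cinner z (A *v z)))"
    unfolding cinner_def matrix_vector_mult_def by (intro continuous_intros)
  ultimately obtain x where x: "x \<in> S" and max: "\<And>z. z \<in> S \<Longrightarrow> Re (cinner z (A *v z)) \<le> Re (cinner x (A *v x))"
    using continuous_attains_sup[of S "\<lambda>z. Re (cinner z (A *v z))"] by blast
  define \<mu> where "\<mu> = Re (cinner x (A *v x))"
  have xV: "x \<in> V" and xx: "cinner x x = 1" using x by (auto simp: S_def cinner_self)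
  have le: "Re (cinner z (A *v z)) \<le> \<mu> * (norm z)\<^sup>2" if "z \<in> V" for z
  proof (cases "z = 0")
    case False
    from max[OF unit[OF that False]] False show ?thesis
      by (simp add: scaleR_eq_scale[of _ z] mult_vec_scale \<mu>_def[symmetric] field_simps power2_eq_square)
  qed simp
  \<comment> \<open>Maximality of \<open>x\<close> says that the form of \<open>B\<close> is
    nonnegative on \<open>V\<close> and zero at \<open>x\<close>. So \<open>B *v x\<close>, and with
    it \<open>A *v x\<close>, is orthogonal to every vector of \<open>V\<close> orthogonal to
    \<open>x\<close>. As \<open>A\<close> need not map \<open>V\<close> into itself, nothing is
    claimed about \<open>A *v x\<close> outside \<open>V\<close>.\<close>
  define B where "B = mat (of_real \<mu>) - A"
  have mat: "mat c *v z = c *s z" for c :: complex and z :: "complex ^ 'n"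
    by (simp add: vec_eq_iff matrix_vector_mult_def mat_def if_distrib[of "\<lambda>u. u * _"] cong: if_cong)
  have B: "B *v z = of_real \<mu> *s z - A *v z" for z
    by (simp add: B_def matrix_vector_mult_diff_rdistrib mat)
  have orth: "cinner y (A *v x) = 0" if "y \<in> V" "cinner x y = 0" for y
  proof -
    have "cinner y (B *v x) = 0"
    proof (rule psd_form_zero[OF V _ _ xV _ that(1)])
      show "cinner u (B *v v) = cinner (B *v u) v" for u v
        by (simp add: B cinner_diff_left cinner_diff_right sa)
      show "0 \<le> Re (cinner z (B *v z))" if "z \<in> V" for z
        using le[OF that] by (simp add: B cinner_diff_right cinner_self[of z] flip: of_real_power)
      show "Re (cinner x (B *v x)) = 0"
        by (simp add: B cinner_diff_right xx \<mu>_def)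
    qed
    moreover have "cinner y x = 0" using that(2) cnj_cinner[of x y] by simp
    ultimately show ?thesis by (simp add: B cinner_diff_right)
  qed
  define W where "W = {y \<in> V. cinner x y = 0}"
  have W: "vec.subspace W"
    using V by (auto simp: W_def vec.subspace_def cinner_add_right)
  have xW: "x \<notin> vec.span W"
  proof
    assume "x \<in> vec.span W"
    then have "x \<in> W" by (metis W vec.span_eq_iff)
    then show False using xx by (simp add: W_def)
  qed
  have VW: "V = vec.span (insert x W)"
  proof
    show "vec.span (insert x W) \<subseteq> V"
      using xV V by (intro vec.span_minimal) (auto simp: W_def)
    show "V \<subseteq> vec.span (insert x W)"
    proof
      fix v assume "v \<in> V"
      then have "v - cinner x v *s x \<in> W" using V xV xx
        by (auto simp: W_def cinner_diff_right vec.subspace_diff vec.subspace_scale)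
      then show "v \<in> vec.span (insert x W)"
        by (metis vec.span_base vec.span_breakdown_eq)
    qed
  qed
  have "d = vec.dim W"
    using Suc.hyps(2) xW vec.dim_insert[of x W] by (simp add: VW vec.dim_span)
  from Suc.hyps(1)[OF this W] obtain w where w: "orthonormal_basis_of d w W"
    and diag: "\<forall>j<d. \<forall>k<d. j \<noteq> k \<longrightarrow> cinner (w j) (A *v w k) = 0"
    by (auto simp: \<open>d = vec.dim W\<close>[symmetric])
  have wW: "w j \<in> W" if "j < d" for j
    using w that by (auto simp: orthonormal_basis_of_def intro: vec.span_base)
  define w' where "w' = (\<lambda>j. if j = d then x else w j)"
  have "w' ` {..<Suc d} = insert x (w ` {..<d})"
    by (auto simp: w'_def lessThan_Suc)
  moreover have "vec.span (insert x (w ` {..<d})) = V"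
  proof
    show "vec.span (insert x (w ` {..<d})) \<subseteq> V"
      using xV V wW by (intro vec.span_minimal) (auto simp: W_def)
    have "W = vec.span (w ` {..<d})" using w by (simp add: orthonormal_basis_of_def)
    also have "\<dots> \<subseteq> vec.span (insert x (w ` {..<d}))" by (rule vec.span_mono) auto
    finally show "V \<subseteq> vec.span (insert x (w ` {..<d}))"
      unfolding VW by (intro vec.span_minimal) (auto intro: vec.span_base)
  qed
  moreover have "cinner (w' j) (w' k) = (if j = k then 1 else 0)" if jk: "j < Suc d" "k < Suc d" for j k
  proof -
    have 1: "cinner (w j) (w k) = (if j = k then 1 else 0)" if "j < d" "k < d" for j k
      using w that by (simp add: orthonormal_basis_of_def)
    have 2: "cinner x (w j) = 0" if "j < d" for j
      using wW[OF that] by (simp add: W_def)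
    have 3: "cinner (w j) x = 0" if "j < d" for j
      using 2[OF that] cnj_cinner[of x "w j"] by simp
    show ?thesis using jk by (auto simp: w'_def less_Suc_eq 1 2 3 xx)
  qed
  moreover have "cinner (w' j) (A *v w' k) = 0" if jk: "j < Suc d" "k < Suc d" "j \<noteq> k" for j k
  proof -
    have 1: "cinner (w j) (A *v x) = 0" if "j < d" for j
      using wW[OF that] orth[of "w j"] by (simp add: W_def)
    have 2: "cinner x (A *v w j) = 0" if "j < d" for j
      using 1[OF that] cnj_cinner[of "w j" "A *v x"] sa[of x "w j"] by simp
    show ?thesis using jk diag by (auto simp: w'_def less_Suc_eq 1 2)
  qed
  ultimately show ?case
    using Suc.hyps(2) by (intro exI[of _ w']) (auto simp: orthonormal_basis_of_def)
qed

section \<open>Spectral theorem, square roots and supports\<close>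

lemma orthonormal_basis_of_cinner:
  "orthonormal_basis_of d w V \<Longrightarrow> j < d \<Longrightarrow> k < d \<Longrightarrow> cinner (w j) (w k) = (if j = k then 1 else 0)"
  by (simp add: orthonormal_basis_of_def)

lemma orthonormal_basis_of_mem: "orthonormal_basis_of d w V \<Longrightarrow> j < d \<Longrightarrow> w j \<in> V"
  by (auto simp: orthonormal_basis_of_def intro: vec.span_base)

lemma cinner_orthonormal_sum:
  assumes "orthonormal_basis_of d w V" "k < d"
  shows "cinner (w k) (\<Sum>j<d. c j *s w j) = c k"
proof -
  have "cinner (w k) (\<Sum>j<d. c j *s w j) = (\<Sum>j<d. c j * cinner (w k) (w j))"
    by (simp add: cinner_sum_right)
  also have "\<dots> = (\<Sum>j<d. if j = k then c j else 0)"
    by (rule sum.cong) (use assms in \<open>auto simp: orthonormal_basis_of_cinner\<close>)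
  finally have "cinner (w k) (\<Sum>j<d. c j *s w j) = (\<Sum>j<d. if j = k then c j else 0)" .
  then show ?thesis using assms(2) by simp
qed

lemma orthogonal_span:
  assumes "\<And>v. v \<in> B \<Longrightarrow> cinner y v = 0" "x \<in> vec.span B"
  shows "cinner y x = 0"
proof -
  have "vec.subspace {x. cinner y x = 0}"
    by (auto simp: vec.subspace_def cinner_add_right)
  with assms show ?thesis using vec.span_minimal[of B "{x. cinner y x = 0}"] by auto
qed

lemma orthonormal_expansion:
  assumes w: "orthonormal_basis_of d w V" and x: "x \<in> V"
  shows "x = (\<Sum>j<d. cinner (w j) x *s w j)"
proof -
  define y where "y = x - (\<Sum>j<d. cinner (w j) x *s w j)"
  have V: "V = vec.span (w ` {..<d})" using w by (simp add: orthonormal_basis_of_def)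
  then have "vec.subspace V" by (simp add: vec.subspace_span)
  then have yV: "y \<in> V" unfolding y_def using x orthonormal_basis_of_mem[OF w]
    by (intro vec.subspace_diff vec.subspace_sum vec.subspace_scale) auto
  have "cinner (w k) y = 0" if "k < d" for k
    using cinner_orthonormal_sum[OF w that] by (simp add: y_def cinner_diff_right)
  then have yw: "cinner y (w k) = 0" if "k < d" for k
    using that cnj_cinner[of "w k" y] by simp
  have "cinner y y = 0"
  proof (rule orthogonal_span)
    show "cinner y v = 0" if "v \<in> w ` {..<d}" for v using that yw by auto
    show "y \<in> vec.span (w ` {..<d})" using yV V by simp
  qed
  then show ?thesis by (simp add: y_def)
qed

lemma double_orthogonal_complement:
  assumes V: "vec.subspace V" and x: "\<And>y. (\<And>v. v \<in> V \<Longrightarrow> cinner y v = 0) \<Longrightarrow> cinner y x = 0"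
  shows "x \<in> (V :: (complex ^ 'n) set)"
proof -
  obtain d w where w: "orthonormal_basis_of d w V"
    \<comment> \<open>With the zero form the diagonalisation just supplies an orthonormal
      basis.\<close>
    using orthonormal_form_diagonalising_basis[of 0 V] V by auto
  define p where "p = (\<Sum>j<d. cinner (w j) x *s w j)"
  define y where "y = x - p"
  have V': "V = vec.span (w ` {..<d})" using w by (simp add: orthonormal_basis_of_def)
  have p: "p \<in> V" unfolding p_def using V orthonormal_basis_of_mem[OF w]
    by (intro vec.subspace_sum vec.subspace_scale) auto
  have "cinner (w k) y = 0" if "k < d" for k
    using cinner_orthonormal_sum[OF w that] by (simp add: y_def p_def cinner_diff_right)
  then have "cinner y (w k) = 0" if "k < d" for k
    using that cnj_cinner[of "w k" y] by simp
  then have orth: "cinner y v = 0" if "v \<in> V" for v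
    using orthogonal_span[of "w ` {..<d}" y v] that V' by auto
  then have "cinner y x = 0" by (rule x)
  with orth[OF p] have "cinner y y = 0" by (simp add: y_def cinner_diff_right)
  with p show ?thesis by (simp add: y_def)
qed

lemma matrix_eq_on_basis:
  assumes u: "orthonormal_basis_of n u UNIV" and eq: "\<And>k. k < n \<Longrightarrow> A *v u k = B *v u k"
  shows "A = (B :: complex ^ 'n ^ 'm)"
  unfolding matrix_eq
proof
  fix x
  have x: "x = (\<Sum>j<n. cinner (u j) x *s u j)" using orthonormal_expansion[OF u] by simp
  have "C *v x = (\<Sum>j<n. cinner (u j) x *s (C *v u j))" for C :: "complex ^ 'n ^ 'm"
    by (subst x) (simp add: vec.linear_sum[OF matrix_vector_mul_linear_gen] vector_scalar_commute)
  then show "A *v x = B *v x" using eq by simp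
qed

section \<open>Spectral decomposition, traces of products and square roots\<close>

lemma spectral_sum_mult_vec:
  assumes "orthonormal_basis_of n u V" "k < n"
  shows "(\<Sum>j<n. f j *\<^sub>R ketbra (u j) (u j)) *v u k = complex_of_real (f k) *s u k"
proof -
  have "(\<Sum>j<n. f j *\<^sub>R ketbra (u j) (u j)) *v u k = (\<Sum>j<n. if j = k then complex_of_real (f j) *s u j else 0)"
    unfolding sum_mult_vec using assms
    by (intro sum.cong) (auto simp: scaleR_mult_vec ketbra_mult_vec orthonormal_basis_of_cinner)
  then show ?thesis using assms(2) by simp
qed

lemma psd_ketbra: "psd (ketbra x x)"
  by (simp add: psd_iff_cinner ketbra_mult_vec complex_nonneg_Reals_iff)
    (simp add: complex_is_Real_iff flip: cnj_cinner[of x])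

lemma psd_0: "psd 0"
  by (simp add: psd_iff_cinner)

lemma psd_add: "psd A \<Longrightarrow> psd B \<Longrightarrow> psd (A + B)"
  by (simp add: psd_iff_cinner matrix_vector_mult_add_rdistrib cinner_add_right)

lemma psd_sum: "(\<And>i. i \<in> I \<Longrightarrow> psd (A i)) \<Longrightarrow> psd (\<Sum>i\<in>I. A i)"
  by (induction I rule: infinite_finite_induct) (simp_all add: psd_0 psd_add)

lemma psd_scaleR: "c \<ge> 0 \<Longrightarrow> psd A \<Longrightarrow> psd (c *\<^sub>R A)"
  by (simp add: psd_iff_cinner scaleR_mult_vec)

lemma psd_spectral:
  assumes "psd A"
  shows "\<exists>n u s. orthonormal_basis_of n u UNIV \<and>
    (\<forall>k<n. s k \<ge> 0 \<and> A *v u k = complex_of_real (s k) *s u k) \<and>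
    A = (\<Sum>k<n. s k *\<^sub>R ketbra (u k) (u k))"
proof -
  obtain n u where u: "orthonormal_basis_of n u UNIV"
    and diag: "\<And>j k. j < n \<Longrightarrow> k < n \<Longrightarrow> j \<noteq> k \<Longrightarrow> cinner (u j) (A *v u k) = 0"
    using orthonormal_form_diagonalising_basis[of A UNIV] psd_selfadjoint[OF assms] by auto
  define s where "s k = Re (cinner (u k) (A *v u k))" for k
  have eig: "A *v u k = complex_of_real (s k) *s u k" if "k < n" for k
  proof -
    have "A *v u k = (\<Sum>j<n. cinner (u j) (A *v u k) *s u j)"
      using orthonormal_expansion[OF u] by simp
    also have "\<dots> = (\<Sum>j<n. if j = k then of_real (s k) *s u k else 0)"
      using diag that psd_cinner[OF assms, of "u k"] by (intro sum.cong) (auto simp: s_def)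
    finally show ?thesis using that by simp
  qed
  have sum: "A = (\<Sum>k<n. s k *\<^sub>R ketbra (u k) (u k))"
    using eig by (intro matrix_eq_on_basis[OF u]) (simp add: spectral_sum_mult_vec[OF u])
  have "s k \<ge> 0" for k
    using psd_Re_nonneg[OF assms] by (simp add: s_def)
  then have "\<forall>k<n. s k \<ge> 0 \<and> A *v u k = complex_of_real (s k) *s u k"
    using eig by blast
  then show ?thesis using u sum by (intro exI conjI)
qed

text \<open>In an eigenbasis of \<open>F\<close> the trace is a sum of nonnegative terms
  \<open>s k\<close> times the form of \<open>B\<close> at \<open>u k\<close>. If it vanishes, each
  eigenvector is killed by \<open>F\<close> or by \<open>B\<close>. This is the source of weak
  duality and of complementary slackness.\<close>

lemma trace_psd_mult_psd:
  assumes B: "psd B" and F: "psd F"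
  shows "Re (trace (B ** F)) \<ge> 0" and "Re (trace (B ** F)) = 0 \<Longrightarrow> B ** F = 0"
proof -
  obtain n u s where u: "orthonormal_basis_of n u UNIV" and s: "\<And>k. k < n \<Longrightarrow> s k \<ge> 0"
    and eig: "\<And>k. k < n \<Longrightarrow> F *v u k = complex_of_real (s k) *s u k"
    and F_eq: "F = (\<Sum>k<n. s k *\<^sub>R ketbra (u k) (u k))"
    using psd_spectral[OF F] by blast
  have "B ** F = (\<Sum>k<n. s k *\<^sub>R (B ** ketbra (u k) (u k)))"
    unfolding F_eq by (simp add: matrix_eq sum_mult_vec mult_vec_sum scaleR_mult_vec mult_vec_scale flip: matrix_vector_mul_assoc)
  then have tr: "Re (trace (B ** F)) = (\<Sum>k<n. s k * Re (cinner (u k) (B *v u k)))"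
    by (simp add: trace_sum trace_scaleR trace_mult_ketbra)
  have nonneg: "s k * Re (cinner (u k) (B *v u k)) \<ge> 0" if "k < n" for k
    using s[OF that] psd_Re_nonneg[OF B] by simp
  show "Re (trace (B ** F)) \<ge> 0"
    unfolding tr using nonneg by (intro sum_nonneg) auto
  assume "Re (trace (B ** F)) = 0"
  then have zero: "s k * Re (cinner (u k) (B *v u k)) = 0" if "k < n" for k
    using nonneg that unfolding tr by (subst (asm) sum_nonneg_eq_0_iff) auto
  show "B ** F = 0"
  proof (rule matrix_eq_on_basis[OF u])
    fix k assume k: "k < n"
    have "B *v u k = 0" if "s k \<noteq> 0"
      using zero[OF k] that psd_cinner[OF B, of "u k"] by (intro psd_form_zero_imp[OF B]) auto
    then show "(B ** F) *v u k = 0 *v u k"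
      by (cases "s k = 0") (simp_all add: eig[OF k] mult_vec_scale flip: matrix_vector_mul_assoc)
  qed
qed

lemma psd_sqrt:
  assumes S: "psd S" and pos: "\<And>x. S *v x = 0 \<Longrightarrow> x = 0"
  obtains Z Y where "psd Z" "Z ** Y = mat 1" "Y ** Z = mat 1" "Z ** Z = S"
proof -
  obtain n u s where u: "orthonormal_basis_of n u UNIV" and s: "\<And>k. k < n \<Longrightarrow> s k \<ge> 0"
    and eig: "\<And>k. k < n \<Longrightarrow> S *v u k = complex_of_real (s k) *s u k"
    using psd_spectral[OF S] by metis
  have s: "s k > 0" if "k < n" for k
  proof -
    have "u k \<noteq> 0" using orthonormal_basis_of_cinner[OF u that that] by auto
    then have "s k \<noteq> 0" using pos[of "u k"] eig[OF that] by auto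
    with s[OF that] show ?thesis by simp
  qed
  define G where "G f = (\<Sum>k<n. f k *\<^sub>R ketbra (u k) (u k))" for f :: "nat \<Rightarrow> real"
  have G: "G f *v u k = complex_of_real (f k) *s u k" if "k < n" for f k
    unfolding G_def using u that by (rule spectral_sum_mult_vec)
  define Z where "Z = G (\<lambda>k. sqrt (s k))"
  define Y where "Y = G (\<lambda>k. 1 / sqrt (s k))"
  have "psd Z" unfolding Z_def G_def
    using s by (intro psd_sum psd_scaleR psd_ketbra) (auto simp: less_imp_le)
  moreover have ZY: "Z ** Y = mat 1"
  proof (rule matrix_eq_on_basis[OF u])
    fix k assume "k < n"
    with s[OF this] show "(Z ** Y) *v u k = mat 1 *v u k"
      by (simp add: Z_def Y_def G mult_vec_scale flip: matrix_vector_mul_assoc of_real_mult)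
  qed
  moreover have "Y ** Z = mat 1" using ZY by (simp add: matrix_left_right_inverse)
  moreover have "Z ** Z = S"
  proof (rule matrix_eq_on_basis[OF u])
    fix k assume "k < n"
    with s[OF this] show "(Z ** Z) *v u k = S *v u k"
      by (simp add: Z_def G eig mult_vec_scale flip: matrix_vector_mul_assoc of_real_mult)
  qed
  ultimately show ?thesis by (rule that)
qed

section \<open>Supports, rank and orthogonal projections\<close>

lemma subspace_supp: "vec.subspace (supp A)"
  by (auto simp: supp_def vec.subspace_def cinner_add_right)

text \<open>Conjugation is antilinear, but it still carries a spanning set to a spanning set. The
  inequality is enough for equality, since conjugation is an involution.\<close>

lemma dim_cnj_le:
  fixes S :: "(complex ^ 'n) set"
  shows "vec.dim ((\<lambda>v. \<chi> a. cnj (v $ a)) ` S) \<le> vec.dim S"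
proof -
  let ?c = "\<lambda>v :: complex ^ 'n. \<chi> a. cnj (v $ a)"
  obtain B where B: "B \<subseteq> S" "vec.independent B" "S \<subseteq> vec.span B" "card B = vec.dim S"
    using vec.basis_exists[of S] by blast
  have fin: "finite B" using B(2) by (rule vec.finiteI_independent)
  have "vec.subspace {v. ?c v \<in> vec.span (?c ` B)}"
  proof -
    have "?c (x + y) = ?c x + ?c y" "?c (c *s x) = cnj c *s ?c x" "?c 0 = 0" for x y c
      by (simp_all add: vec_eq_iff)
    then show ?thesis
      by (simp add: vec.subspace_def vec.span_add vec.span_scale vec.span_zero)
  qed
  then have "vec.span B \<subseteq> {v. ?c v \<in> vec.span (?c ` B)}"
    by (intro vec.span_minimal) (auto intro: vec.span_base)
  with B(3) have "vec.dim (?c ` S) \<le> card (?c ` B)"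
    by (intro vec.dim_le_card) (use fin in auto)
  also have "\<dots> \<le> vec.dim S"
    using card_image_le[OF fin, of ?c] B(4) by simp
  finally show ?thesis .
qed

lemma dim_cnj:
  fixes S :: "(complex ^ 'n) set"
  shows "vec.dim ((\<lambda>v. \<chi> a. cnj (v $ a)) ` S) = vec.dim S"
  using dim_cnj_le[of S] dim_cnj_le[of "(\<lambda>v. \<chi> a. cnj (v $ a)) ` S"]
  by (simp add: image_image)

text \<open>The support is spanned by the conjugated rows.\<close>

lemma rank_eq_dim_supp: "rank A = vec.dim (supp (A :: complex ^ 'n ^ 'n))"
proof -
  define R where "R = (\<lambda>v. \<chi> a. cnj (v $ a)) ` rows A"
  have ker: "A *v y = 0 \<longleftrightarrow> (\<forall>v\<in>R. cinner v y = 0)" for y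
  proof -
    have "R = range (\<lambda>i. \<chi> a. cnj (A $ i $ a))"
      by (auto simp: R_def rows_def row_def)
    moreover have "A *v y = 0 \<longleftrightarrow> (\<forall>i. cinner (\<chi> a. cnj (A $ i $ a)) y = 0)"
      unfolding vec_eq_iff[of "A *v y"] by (simp add: cinner_def matrix_vector_mult_def)
    ultimately show ?thesis by simp
  qed
  have "supp A = vec.span R"
  proof
    show "vec.span R \<subseteq> supp A"
    proof (rule vec.span_minimal[OF _ subspace_supp], rule)
      fix v assume v: "v \<in> R"
      have "cinner y v = 0" if "A *v y = 0" for y
        using that ker v cnj_cinner[of v y] by simp
      then show "v \<in> supp A" by (simp add: supp_def)
    qed
    show "supp A \<subseteq> vec.span R"
    proof
      fix x assume x: "x \<in> supp A"
      show "x \<in> vec.span R"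
      proof (rule double_orthogonal_complement[OF vec.subspace_span])
        fix y assume *: "\<And>v. v \<in> vec.span R \<Longrightarrow> cinner y v = 0"
        have "cinner v y = 0" if "v \<in> R" for v
          using *[OF vec.span_base[OF that]] cnj_cinner[of y v] by simp
        then show "cinner y x = 0" using x ker by (auto simp: supp_def)
      qed
    qed
  qed
  then show ?thesis
    unfolding row_rank_def_gen using dim_cnj[of "rows A"] by (simp add: R_def vec.dim_span)
qed

lemma supp_cong: "(\<And>y. A *v y = 0 \<longleftrightarrow> B *v y = 0) \<Longrightarrow> supp A = supp B"
  by (simp add: supp_def)

lemma supp_scaleR: "c \<noteq> 0 \<Longrightarrow> supp (c *\<^sub>R A) = supp (A :: complex ^ 'n ^ 'n)"
  by (rule supp_cong) (simp add: scaleR_mult_vec)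

lemma psd_range_supp:
  assumes "psd A"
  shows "A *v x \<in> supp A"
  by (simp add: supp_def psd_selfadjoint[OF assms])

lemma projection_supp:
  assumes P: "psd P" "P ** P = P" and x: "x \<in> supp P"
  shows "P *v x = x"
proof -
  define y where "y = x - P *v x"
  have Py: "P *v y = 0"
    using P(2) by (simp add: y_def matrix_vector_mult_diff_distrib matrix_vector_mul_assoc)
  have "cinner y y = cinner y (x - P *v x)" by (simp add: y_def)
  also have "\<dots> = cinner y x - cinner (P *v y) x"
    by (simp only: cinner_diff_right psd_selfadjoint[OF P(1)])
  also have "\<dots> = 0" using Py x by (simp add: supp_def)
  finally show ?thesis by (simp add: y_def)
qed

text \<open>Removes the dependence on the basis chosen in an admissible choice: only the projection
  survives.\<close>

lemma projection_eq_sum_ketbra: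
  assumes P: "psd P" "P ** P = P" and w: "orthonormal_basis_of d w (supp P)"
  shows "P = (\<Sum>k<d. ketbra (w k) (w k))"
  unfolding matrix_eq
proof
  fix x
  have "P *v w k = w k" if "k < d" for k
    using projection_supp[OF P orthonormal_basis_of_mem[OF w that]] .
  then have "cinner (w k) (P *v x) = cinner (w k) x" if "k < d" for k
    using that psd_selfadjoint[OF P(1), of "w k" x] by simp
  moreover have "P *v x = (\<Sum>k<d. cinner (w k) (P *v x) *s w k)"
    using orthonormal_expansion[OF w psd_range_supp[OF P(1)]] .
  ultimately show "P *v x = (\<Sum>k<d. ketbra (w k) (w k)) *v x"
    by (simp add: sum_mult_vec ketbra_mult_vec)
qed

section \<open>The ensemble built from a projective measurement\<close>

lemma trace_diff: "trace (A - B) = trace A - trace (B :: complex ^ 'n ^ 'n)"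
  by (simp add: trace_def sum_subtractf)

lemma matrix_mul_diff_left: "(A - B) ** C = A ** C - B ** (C :: complex ^ 'n ^ 'n)"
  by (simp add: matrix_eq matrix_vector_mult_diff_rdistrib flip: matrix_vector_mul_assoc)

lemma sum_ketbra_mult_vec:
  "(\<Sum>j<d. ketbra (\<psi> j) (\<psi> j)) *v x = (\<Sum>j<d. cinner (\<psi> j) x *s \<psi> j)"
  by (simp add: sum_mult_vec ketbra_mult_vec)

lemma psd_sum_ketbra: "psd (\<Sum>j<d. ketbra (\<psi> j) (\<psi> j))"
  by (rule psd_sum) (rule psd_ketbra)

text \<open>The coefficients of \<open>chi_vec\<close> are overlaps of the \<psi> vectors with w_ij,
  so that \<open>chi_vec\<close> is the operator p_i rho_i applied to w_ij. The result sees the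
  choices only through p_i rho_i and the projection onto the span of the w_ij.\<close>

lemma sum_ketbra_chi_vec:
  "(\<Sum>j<r ! i. ketbra (chi_vec r \<psi> w i j) (chi_vec r \<psi> w i j)) =
    (\<Sum>j<r ! i. ketbra (\<psi> i j) (\<psi> i j)) ** (\<Sum>j<r ! i. ketbra (w i j) (w i j)) **
    (\<Sum>j<r ! i. ketbra (\<psi> i j) (\<psi> i j))"
proof -
  define T where "T = (\<Sum>j<r ! i. ketbra (\<psi> i j) (\<psi> i j))"
  have T: "psd T" unfolding T_def by (rule psd_sum_ketbra)
  have chi: "chi_vec r \<psi> w i j = T *v w i j" for j
    by (simp add: chi_vec_def X_block_def T_def sum_ketbra_mult_vec)
  show ?thesis
    unfolding chi T_def[symmetric] matrix_eq
    by (simp add: sum_mult_vec ketbra_mult_vec mult_vec_sum mult_vec_scale psd_selfadjoint[OF T]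
        flip: matrix_vector_mul_assoc)
qed

lemma independent_subspaces_cong:
  "(\<And>i. i < m \<Longrightarrow> V i = W i) \<Longrightarrow> independent_subspaces m V \<longleftrightarrow> independent_subspaces m W"
  by (simp add: independent_subspaces_def)

text \<open>Collects what the construction takes from Q. \<open>Y\<close> is the inverse of
  \<open>Z\<close>; the relation of Q to \<open>Z ** Pr i ** Z\<close> is left out and enters only
  when the image under \<open>R_map\<close> is computed.\<close>

locale projective_measurement_frame =
  fixes r :: "nat list" and Z Y :: "complex ^ 'n ^ 'n" and Pr :: "nat \<Rightarrow> complex ^ 'n ^ 'n"
    and w :: "nat \<Rightarrow> nat \<Rightarrow> complex ^ 'n"
  assumes rank_pos: "i < length r \<Longrightarrow> r ! i > 0"
    and nonempty: "length r > 0"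
    and Z_psd: "psd Z" and ZY: "Z ** Y = mat 1" and YZ: "Y ** Z = mat 1"
    and Pr_psd: "i < length r \<Longrightarrow> psd (Pr i)"
    and Pr_sum: "(\<Sum>i<length r. Pr i) = mat 1"
    and Pr_mult: "i < length r \<Longrightarrow> j < length r \<Longrightarrow> Pr i ** Pr j = (if i = j then Pr i else 0)"
    and basis: "i < length r \<Longrightarrow> orthonormal_basis_of (r ! i) (w i) (supp (Pr i))"
    and diagonal: "i < length r \<Longrightarrow> j < r ! i \<Longrightarrow> k < r ! i \<Longrightarrow> j \<noteq> k \<Longrightarrow> cinner (w i j) (Z *v w i k) = 0"
begin

text \<open>
  \<open>T i\<close> is \<open>Z \<Pi>\<^sub>i (\<Pi>\<^sub>i Z \<Pi>\<^sub>i)\<^sup>+ \<Pi>\<^sub>i Z\<close>, where \<open>\<Pi>\<^sub>i = Pr i\<close> and \<open>+\<close> is the pseudoinverse; it equals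
  \<open>\<nu> p\<^sub>i \<rho>\<^sub>i\<close> for the ensemble below, and \<open>Z\<close> is the optimal dual variable of the discrimination problem.
\<close>

definition \<Lambda> :: "nat \<Rightarrow> nat \<Rightarrow> real"
  where "\<Lambda> i j = Re (cinner (w i j) (Z *v w i j))"

definition \<phi> :: "nat \<Rightarrow> nat \<Rightarrow> complex ^ 'n"
  where "\<phi> i j = complex_of_real (1 / sqrt (\<Lambda> i j)) *s (Z *v w i j)"

definition T :: "nat \<Rightarrow> complex ^ 'n ^ 'n"
  where "T i = (\<Sum>j<r ! i. ketbra (\<phi> i j) (\<phi> i j))"

definition \<tau> :: "nat \<Rightarrow> real"
  where "\<tau> i = Re (trace (T i))"

definition \<nu> :: real
  where "\<nu> = (\<Sum>i<length r. \<tau> i)"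

definition preimage_ensemble :: "'n ensemble"
  where "preimage_ensemble = map (\<lambda>i. (\<tau> i / \<nu>, (1 / \<tau> i) *\<^sub>R T i)) [0..<length r]"

lemma Y_Z_vec [simp]: "Y *v (Z *v x) = x"
  by (simp add: matrix_vector_mul_assoc YZ)

lemma Z_eq_0_iff [simp]: "Z *v x = 0 \<longleftrightarrow> x = 0"
  by (metis Y_Z_vec matrix_vector_mult_0_right)

lemma Pr_idem: "i < length r \<Longrightarrow> Pr i ** Pr i = Pr i"
  by (simp add: Pr_mult)

lemma Pr_w: "i < length r \<Longrightarrow> j < r ! i \<Longrightarrow> Pr i *v w i j = w i j"
  by (rule projection_supp[OF Pr_psd Pr_idem orthonormal_basis_of_mem[OF basis]])

lemma w_nonzero: "i < length r \<Longrightarrow> j < r ! i \<Longrightarrow> w i j \<noteq> 0"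
  using orthonormal_basis_of_cinner[OF basis, of i j j] by auto

lemma \<Lambda>_pos:
  assumes "i < length r" "j < r ! i"
  shows "\<Lambda> i j > 0"
proof -
  have "cinner (w i j) (Z *v w i j) \<noteq> 0"
    using psd_form_zero_imp[OF Z_psd, of "w i j"] w_nonzero[OF assms] by auto
  then have "\<Lambda> i j \<noteq> 0"
    using psd_cinner[OF Z_psd, of "w i j"] unfolding \<Lambda>_def by (metis of_real_0)
  moreover have "\<Lambda> i j \<ge> 0" unfolding \<Lambda>_def by (rule psd_Re_nonneg[OF Z_psd])
  ultimately show ?thesis by simp
qed

lemma cinner_\<phi>_w:
  assumes "i < length r" "j < r ! i" "k < r ! i"
  shows "cinner (\<phi> i j) (w i k) = (if j = k then complex_of_real (sqrt (\<Lambda> i j)) else 0)"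
proof -
  have "cinner (w i j) (Z *v w i k) = (if j = k then complex_of_real (\<Lambda> i j) else 0)"
  proof (cases "j = k")
    case True
    have "cinner (w i j) (Z *v w i j) = complex_of_real (\<Lambda> i j)"
      unfolding \<Lambda>_def by (rule psd_cinner[OF Z_psd])
    with True show ?thesis by simp
  qed (use diagonal[OF assms] in simp)
  then have "cinner (Z *v w i j) (w i k) = (if j = k then complex_of_real (\<Lambda> i j) else 0)"
    by (simp only: psd_selfadjoint[OF Z_psd])
  then have *: "cinner (\<phi> i j) (w i k) =
      complex_of_real (1 / sqrt (\<Lambda> i j)) * (if j = k then complex_of_real (\<Lambda> i j) else 0)"
    by (simp add: \<phi>_def)
  have "1 / sqrt (\<Lambda> i j) * \<Lambda> i j = sqrt (\<Lambda> i j)"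
    using \<Lambda>_pos[OF assms(1,2)] by (simp add: real_div_sqrt)
  then have "complex_of_real (1 / sqrt (\<Lambda> i j)) * complex_of_real (\<Lambda> i j) = complex_of_real (sqrt (\<Lambda> i j))"
    by (metis of_real_mult)
  then show ?thesis unfolding * by (cases "j = k") simp_all
qed

lemma T_psd: "psd (T i)"
  unfolding T_def by (rule psd_sum_ketbra)

lemma T_vec: "T i *v x = (\<Sum>j<r ! i. cinner (\<phi> i j) x *s \<phi> i j)"
  unfolding T_def by (rule sum_ketbra_mult_vec)

text \<open>The overlap of \<open>\<phi> i k\<close> with \<open>w i k\<close> is the square root of
  \<open>\<Lambda> i k\<close> and cancels the factor in \<open>\<phi>\<close>; this fixes the
  normalisation of \<open>\<phi>\<close>.\<close>

lemma T_w:
  assumes "i < length r" "k < r ! i"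
  shows "T i *v w i k = Z *v w i k"
proof -
  have "T i *v w i k = (\<Sum>j<r ! i. if j = k then complex_of_real (sqrt (\<Lambda> i k)) *s \<phi> i k else 0)"
    unfolding T_vec by (rule sum.cong) (use assms in \<open>auto simp: cinner_\<phi>_w\<close>)
  also have "\<dots> = complex_of_real (sqrt (\<Lambda> i k)) *s \<phi> i k" using assms by simp
  also have "\<dots> = Z *v w i k"
    using \<Lambda>_pos[OF assms] by (simp add: \<phi>_def vector_smult_assoc flip: of_real_mult)
  finally show ?thesis .
qed

lemma T_Pr_vec:
  assumes "i < length r"
  shows "T i *v (Pr i *v x) = Z *v (Pr i *v x)"
proof -
  define c where "c j = cinner (w i j) (Pr i *v x)" for j
  have "Pr i *v x = (\<Sum>j<r ! i. c j *s w i j)"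
    unfolding c_def
    using orthonormal_expansion[OF basis[OF assms] psd_range_supp[OF Pr_psd[OF assms]]] .
  then show ?thesis
    using assms by (simp add: mult_vec_sum mult_vec_scale T_w)
qed

text \<open>The adjoint of \<open>T_Pr_vec\<close>, all three operators being self-adjoint.\<close>

lemma Pr_T_vec:
  assumes "i < length r"
  shows "Pr i *v (T i *v x) = Pr i *v (Z *v x)"
proof (rule cinner_eqI)
  fix y
  have "cinner y (Pr i *v (T i *v x)) = cinner (T i *v (Pr i *v y)) x"
    by (simp only: psd_selfadjoint[OF T_psd] psd_selfadjoint[OF Pr_psd[OF assms]])
  also have "\<dots> = cinner y (Pr i *v (Z *v x))"
    by (simp only: T_Pr_vec[OF assms] psd_selfadjoint[OF Z_psd] psd_selfadjoint[OF Pr_psd[OF assms]])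
  finally show "cinner y (Pr i *v (T i *v x)) = cinner y (Pr i *v (Z *v x))" .
qed

lemma T_range:
  assumes "i < length r"
  obtains v where "T i *v x = Z *v v" "Pr i *v v = v"
proof
  define v where "v = (\<Sum>j<r ! i. (cinner (\<phi> i j) x * complex_of_real (1 / sqrt (\<Lambda> i j))) *s w i j)"
  show "T i *v x = Z *v v"
    by (simp add: T_vec v_def mult_vec_sum mult_vec_scale \<phi>_def[of i] vector_smult_assoc)
  show "Pr i *v v = v"
    unfolding v_def using assms by (simp add: mult_vec_sum mult_vec_scale Pr_w)
qed

text \<open>Dual feasibility. \<open>Z - T i\<close> is a Schur complement: its form at
  \<open>x\<close> is the form of \<open>Z\<close> at the component of \<open>x\<close> that is
  \<open>Z\<close>-orthogonal to the range of \<open>Pr i\<close>.\<close>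

lemma Z_diff_T_psd:
  assumes "i < length r"
  shows "psd (Z - T i)"
  unfolding psd_iff_cinner
proof
  fix x
  txt \<open>\<open>v\<close> is the orthogonal projection of \<open>x\<close> onto the range of \<open>Pr i\<close> for the inner product given by \<open>Z\<close>.\<close>
  obtain v where v: "T i *v x = Z *v v" "Pr i *v v = v" using T_range[OF assms] .
  define t where "t = cinner x (T i *v x)"
  have t: "cinner (T i *v x) x = t" by (simp add: t_def psd_selfadjoint[OF T_psd])
  have Tv: "T i *v v = T i *v x" using T_Pr_vec[OF assms, of v] v by simp
  have "cinner v (Z *v x) = cinner (Z *v v) x" by (rule psd_selfadjoint[OF Z_psd])
  then have 1: "cinner v (Z *v x) = t" using t v by simp
  have "cinner v (Z *v v) = cinner (T i *v v) x"
    unfolding v(1)[symmetric] by (rule psd_selfadjoint[OF T_psd])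
  then have 2: "cinner v (Z *v v) = t" using Tv t by simp
  have 3: "cinner x (Z *v v) = t" by (simp add: t_def v(1))
  have "cinner (x - v) (Z *v (x - v)) = cinner x ((Z - T i) *v x)"
    by (simp add: cinner_diff_left cinner_diff_right matrix_vector_mult_diff_distrib
        matrix_vector_mult_diff_rdistrib 1 2 3 t_def[symmetric])
  then show "cinner x ((Z - T i) *v x) \<in> \<real>\<^sub>\<ge>\<^sub>0"
    using Z_psd unfolding psd_iff_cinner by metis
qed

section \<open>Duality and uniqueness of the optimal measurement\<close>

lemma trace_T_Pr: "(\<Sum>i<length r. Re (trace (T i ** Pr i))) = Re (trace Z)"
proof -
  have "T i ** Pr i = Z ** Pr i" if "i < length r" for i
    using T_Pr_vec[OF that] by (simp add: matrix_eq flip: matrix_vector_mul_assoc)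
  then have "(\<Sum>i<length r. Re (trace (T i ** Pr i))) = Re (trace (\<Sum>i<length r. Z ** Pr i))"
    by (simp add: trace_sum)
  then show ?thesis by (simp add: Pr_sum flip: matrix_mul_sum)
qed

text \<open>Completeness of \<open>F\<close> splits the trace of \<open>Z\<close> over the outcomes,
  so the gap is a sum of slack terms, each nonnegative for a POVM.\<close>

lemma dual_gap:
  assumes "(\<Sum>i<length r. F i) = mat 1"
  shows "Re (trace Z) - (\<Sum>i<length r. Re (trace (T i ** F i))) = (\<Sum>i<length r. Re (trace ((Z - T i) ** F i)))"
proof -
  have "Re (trace Z) = Re (trace (Z ** (\<Sum>i<length r. F i)))" by (simp add: assms)
  also have "\<dots> = (\<Sum>i<length r. Re (trace (Z ** F i)))"
    by (simp add: matrix_mul_sum trace_sum)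
  finally show ?thesis
    by (simp add: matrix_mul_diff_left trace_diff sum_subtractf)
qed

lemma trace_T_le:
  assumes "\<And>i. i < length r \<Longrightarrow> psd (F i)" "(\<Sum>i<length r. F i) = mat 1"
  shows "(\<Sum>i<length r. Re (trace (T i ** F i))) \<le> Re (trace Z)"
proof -
  have "(\<Sum>i<length r. Re (trace ((Z - T i) ** F i))) \<ge> 0"
    using assms(1) Z_diff_T_psd trace_psd_mult_psd(1) by (intro sum_nonneg) auto
  then show ?thesis using dual_gap[OF assms(2)] by simp
qed

text \<open>Complementary slackness puts the range of \<open>F j\<close> into the kernel of
  \<open>Z - T j\<close>, which lies in the range of \<open>Pr j\<close>. Completeness of
  \<open>F\<close> and mutual orthogonality of the projections then leave only
  \<open>F i = Pr i\<close>.\<close>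

lemma trace_T_eq_imp:
  assumes F: "\<And>i. i < length r \<Longrightarrow> psd (F i)" "(\<Sum>i<length r. F i) = mat 1"
    and eq: "(\<Sum>i<length r. Re (trace (T i ** F i))) = Re (trace Z)"
    and i: "i < length r"
  shows "F i = Pr i"
proof -
  have "(\<Sum>i<length r. Re (trace ((Z - T i) ** F i))) = 0"
    using dual_gap[OF F(2)] eq by simp
  moreover have "Re (trace ((Z - T j) ** F j)) \<ge> 0" if "j < length r" for j
    using F(1) Z_diff_T_psd trace_psd_mult_psd(1) that by blast
  ultimately have "Re (trace ((Z - T j) ** F j)) = 0" if "j < length r" for j
    using that by (subst (asm) sum_nonneg_eq_0_iff) auto
  then have zero: "(Z - T j) ** F j = 0" if "j < length r" for j
    using F(1) Z_diff_T_psd trace_psd_mult_psd(2) that by blast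
  have range: "Pr j *v (F j *v x) = F j *v x" if j: "j < length r" for j x
  proof -
    have "(Z - T j) *v (F j *v x) = 0"
      by (simp add: matrix_vector_mul_assoc zero[OF j])
    \<comment> \<open>Values of \<open>T j\<close> have the form \<open>Z *v v\<close> with
      \<open>v\<close> fixed by \<open>Pr j\<close>, and \<open>Z\<close> is injective, so
      \<open>F j *v x\<close> is that \<open>v\<close>.\<close>
    then have "Z *v (F j *v x) = T j *v (F j *v x)"
      by (simp add: matrix_vector_mult_diff_rdistrib)
    moreover obtain v where "T j *v (F j *v x) = Z *v v" "Pr j *v v = v"
      using T_range[OF j] .
    ultimately show ?thesis by (metis Y_Z_vec)
  qed
  show ?thesis
    unfolding matrix_eq
  proof
    fix x
    have "x = (\<Sum>j<length r. F j *v x)" by (simp add: F(2) flip: sum_mult_vec)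
    then have "Pr i *v x = (\<Sum>j<length r. Pr i *v (F j *v x))"
      by (metis (no_types) mult_vec_sum)
    also have "\<dots> = (\<Sum>j<length r. if j = i then F i *v x else 0)"
    proof (rule sum.cong)
      fix j assume "j \<in> {..<length r}"
      then have j: "j < length r" by simp
      have "Pr i *v (F j *v x) = (Pr i ** Pr j) *v (F j *v x)"
        by (simp add: range[OF j] flip: matrix_vector_mul_assoc)
      then show "Pr i *v (F j *v x) = (if j = i then F i *v x else 0)"
        using range[OF j, of x] Pr_mult[OF i j] by auto
    qed simp
    finally show "F i *v x = Pr i *v x" using i by simp
  qed
qed

section \<open>Normalisation, membership in the class, and the image under
  \<open>R_map\<close>\<close>

lemma trace_T: "trace (T i) = complex_of_real (\<tau> i)"
  by (simp add: \<tau>_def T_def trace_sum trace_ketbra cinner_self)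

lemma \<tau>_pos:
  assumes "i < length r"
  shows "\<tau> i > 0"
proof -
  have "\<tau> i = (\<Sum>j<r ! i. (norm (\<phi> i j))\<^sup>2)"
    by (simp add: \<tau>_def T_def trace_sum trace_ketbra cinner_self flip: of_real_power)
  moreover have "\<phi> i j \<noteq> 0" if "j < r ! i" for j
    using cinner_\<phi>_w[OF assms that that] \<Lambda>_pos[OF assms that] by auto
  ultimately show ?thesis
    using rank_pos[OF assms] by (simp, intro sum_pos) auto
qed

lemma \<nu>_pos: "\<nu> > 0"
  unfolding \<nu>_def using \<tau>_pos nonempty by (intro sum_pos) auto

text \<open>Both kernels consist of the \<open>y\<close> with
  \<open>Pr i *v (Z *v y) = 0\<close>.\<close>

lemma supp_T:
  assumes "i < length r"
  shows "supp (T i) = supp (Z ** Pr i ** Z)"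
proof (rule supp_cong)
  fix y
  have "T i *v y = 0 \<longleftrightarrow> Pr i *v (Z *v y) = 0"
  proof
    assume "T i *v y = 0"
    then show "Pr i *v (Z *v y) = 0" using Pr_T_vec[OF assms, of y] by simp
  next
    assume *: "Pr i *v (Z *v y) = 0"
    have "cinner (\<phi> i j) y = 0" if "j < r ! i" for j
    proof -
      have "cinner (Z *v w i j) y = cinner (w i j) (Z *v y)"
        by (rule psd_selfadjoint[OF Z_psd, symmetric])
      also have "\<dots> = cinner (Pr i *v w i j) (Z *v y)" by (simp add: Pr_w assms that)
      also have "\<dots> = cinner (w i j) (Pr i *v (Z *v y))"
        by (rule psd_selfadjoint[OF Pr_psd[OF assms], symmetric])
      finally show ?thesis using * by (simp add: \<phi>_def)
    qed
    then show "T i *v y = 0" by (simp add: T_vec)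
  qed
  then show "T i *v y = 0 \<longleftrightarrow> (Z ** Pr i ** Z) *v y = 0"
    by (simp flip: matrix_vector_mul_assoc)
qed

lemma length_preimage [simp]: "length preimage_ensemble = length r"
  by (simp add: preimage_ensemble_def)

lemma prob_preimage: "i < length r \<Longrightarrow> prob preimage_ensemble i = \<tau> i / \<nu>"
  by (simp add: preimage_ensemble_def)

lemma state_preimage: "i < length r \<Longrightarrow> state preimage_ensemble i = (1 / \<tau> i) *\<^sub>R T i"
  by (simp add: preimage_ensemble_def)

lemma prob_state_preimage:
  "i < length r \<Longrightarrow> prob preimage_ensemble i *\<^sub>R state preimage_ensemble i = (1 / \<nu>) *\<^sub>R T i"
  using \<tau>_pos[of i] by (simp add: prob_preimage state_preimage)

lemma supp_preimage: "i < length r \<Longrightarrow> supp (state preimage_ensemble i) = supp (Z ** Pr i ** Z)"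
  using \<tau>_pos[of i] by (simp add: state_preimage supp_scaleR supp_T)

text \<open>The hypotheses are about \<open>Z ** Pr i ** Z\<close> because this will be a positive
  multiple of sigma_i; they are then the rank and support conditions already satisfied by Q.\<close>

lemma preimage_in_ensembles:
  assumes rank: "\<And>i. i < length r \<Longrightarrow> vec.dim (supp (Z ** Pr i ** Z)) = r ! i"
    and ind: "independent_subspaces (length r) (\<lambda>i. supp (Z ** Pr i ** Z))"
    and span: "vec.span (\<Union>i<length r. supp (Z ** Pr i ** Z)) = UNIV"
  shows "preimage_ensemble \<in> ensembles r"
proof -
  have "(\<Sum>i<length r. prob preimage_ensemble i) = 1"
    using \<nu>_pos by (simp add: prob_preimage \<nu>_def flip: sum_divide_distrib)
  moreover have "density_operator (state preimage_ensemble i)" if "i < length r" for i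
    using \<tau>_pos[OF that] T_psd[of i]
    by (simp add: density_operator_def state_preimage that psd_scaleR trace_scaleR trace_T)
  moreover have "independent_subspaces (length r) (\<lambda>i. supp (state preimage_ensemble i))"
    by (rule iffD2[OF independent_subspaces_cong ind]) (rule supp_preimage)
  ultimately show ?thesis
    using \<tau>_pos \<nu>_pos rank span
    by (simp add: ensembles_def prob_preimage rank_eq_dim_supp supp_preimage)
qed

lemma success_prob_preimage:
  "success_prob preimage_ensemble E = (\<Sum>i<length r. Re (trace (T i ** E ! i))) / \<nu>"
proof -
  have "prob preimage_ensemble i * Re (trace (state preimage_ensemble i ** E ! i)) = Re (trace (T i ** E ! i)) / \<nu>"
    if "i < length r" for i
  proof -
    have "(c *\<^sub>R A) ** B = c *\<^sub>R (A ** B)" for c and A B :: "complex ^ 'n ^ 'n"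
      by (simp add: matrix_eq scaleR_mult_vec flip: matrix_vector_mul_assoc)
    then show ?thesis
      using \<tau>_pos[OF that] that by (simp add: prob_preimage state_preimage trace_scaleR)
  qed
  then show ?thesis
    by (simp add: success_prob_def sum_divide_distrib)
qed

text \<open>An equivalence, so that the measurement inside an arbitrary admissible choice can be
  replaced by \<open>Pr\<close>.\<close>

lemma optimal_povm_preimage:
  "optimal_povm preimage_ensemble E \<longleftrightarrow> E = map Pr [0..<length r]"
proof -
  have povm: "povm (length r) (map Pr [0..<length r])"
    by (simp add: povm_def Pr_psd Pr_sum)
  have opt: "success_prob preimage_ensemble (map Pr [0..<length r]) = Re (trace Z) / \<nu>"
    by (simp add: success_prob_preimage trace_T_Pr)
  have le: "success_prob preimage_ensemble F \<le> Re (trace Z) / \<nu>" if "povm (length r) F" for F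
    unfolding success_prob_preimage using that \<nu>_pos
    by (intro divide_right_mono trace_T_le) (auto simp: povm_def)
  show ?thesis
  proof
    assume "E = map Pr [0..<length r]"
    then show "optimal_povm preimage_ensemble E"
      using povm opt le by (simp add: optimal_povm_def)
  next
    assume E: "optimal_povm preimage_ensemble E"
    then have povmE: "povm (length r) E" by (simp add: optimal_povm_def)
    have "success_prob preimage_ensemble E = Re (trace Z) / \<nu>"
      using E povm opt le[OF povmE] by (force simp: optimal_povm_def)
    then have "(\<Sum>i<length r. Re (trace (T i ** E ! i))) = Re (trace Z)"
      using \<nu>_pos by (simp add: success_prob_preimage)
    then have Pr: "E ! i = Pr i" if "i < length r" for i
      using povmE by (intro trace_T_eq_imp[of "\<lambda>i. E ! i", OF _ _ _ that]) (auto simp: povm_def)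
    have "length E = length r" using povmE by (simp add: povm_def)
    then show "E = map Pr [0..<length r]"
      using Pr by (intro nth_equalityI) simp_all
  qed
qed

lemma admissible_choice_exists:
  "admissible_choice r preimage_ensemble (map Pr [0..<length r])
    (\<lambda>i j. complex_of_real (1 / sqrt \<nu>) *s \<phi> i j) w"
proof -
  let ?\<psi> = "\<lambda>i j. complex_of_real (1 / sqrt \<nu>) *s \<phi> i j"
  have "prob preimage_ensemble i *\<^sub>R state preimage_ensemble i = (\<Sum>j<r ! i. ketbra (?\<psi> i j) (?\<psi> i j))"
    if "i < length r" for i
  proof -
    have "ketbra (complex_of_real c *s x) (complex_of_real c *s x) = (c * c) *\<^sub>R ketbra x x" for c and x :: "complex ^ 'n"
      by (simp add: matrix_eq ketbra_mult_vec scaleR_mult_vec vector_smult_assoc algebra_simps)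
    then show ?thesis
      using \<nu>_pos by (simp add: prob_state_preimage[OF that] T_def scaleR_sum_right del: of_real_divide)
  qed
  moreover have "psd_on {..<r ! i} (X_block ?\<psi> w i)" if "i < length r" for i
  proof -
    have "(\<Sum>a<r ! i. \<Sum>b<r ! i. cnj (c a) * X_block ?\<psi> w i a b * c b)
        = (\<Sum>a<r ! i. complex_of_real (sqrt (\<Lambda> i a) / sqrt \<nu> * (cmod (c a))\<^sup>2))" for c
    proof (rule sum.cong)
      fix a assume "a \<in> {..<r ! i}"
      then have a: "a < r ! i" by simp
      have "(\<Sum>b<r ! i. cnj (c a) * X_block ?\<psi> w i a b * c b)
          = (\<Sum>b<r ! i. if b = a then cnj (c a) * complex_of_real (sqrt (\<Lambda> i a) / sqrt \<nu>) * c a else 0)"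
        by (rule sum.cong) (use a that in \<open>auto simp: X_block_def cinner_\<phi>_w\<close>)
      also have "\<dots> = cnj (c a) * complex_of_real (sqrt (\<Lambda> i a) / sqrt \<nu>) * c a"
        using a by simp
      also have "\<dots> = complex_of_real (sqrt (\<Lambda> i a) / sqrt \<nu>) * (c a * cnj (c a))"
        by (simp only: mult_ac)
      also have "\<dots> = complex_of_real (sqrt (\<Lambda> i a) / sqrt \<nu> * (cmod (c a))\<^sup>2)"
        by (simp only: complex_norm_square[symmetric] of_real_mult)
      finally show "(\<Sum>b<r ! i. cnj (c a) * X_block ?\<psi> w i a b * c b) =
          complex_of_real (sqrt (\<Lambda> i a) / sqrt \<nu> * (cmod (c a))\<^sup>2)" .
    qed simp
    moreover have "(\<Sum>a<r ! i. sqrt (\<Lambda> i a) / sqrt \<nu> * (cmod (c a))\<^sup>2) \<ge> 0" for c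
      using \<Lambda>_pos[OF that] \<nu>_pos by (intro sum_nonneg) (simp add: less_imp_le)
    ultimately show ?thesis
      unfolding psd_on_def by (simp only: of_real_sum[symmetric] nonneg_Reals_of_real_iff) simp
  qed
  ultimately show ?thesis
    unfolding admissible_choice_def optimal_povm_preimage using basis by simp
qed

text \<open>The sum is (T/\<nu>) Pr (T/\<nu>), and next to \<open>Pr i\<close> the operator
  \<open>T i\<close> may be replaced by \<open>Z\<close> on either side.\<close>

lemma admissible_choice_chi:
  assumes adm: "admissible_choice r preimage_ensemble E \<psi> v" and i: "i < length r"
  shows "(\<Sum>j<r ! i. ketbra (chi_vec r \<psi> v i j) (chi_vec r \<psi> v i j)) = (1 / \<nu>\<^sup>2) *\<^sub>R (Z ** Pr i ** Z)"
proof -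
  have E: "E ! i = Pr i" using adm i by (simp add: admissible_choice_def optimal_povm_preimage)
  have \<psi>: "(\<Sum>j<r ! i. ketbra (\<psi> i j) (\<psi> i j)) = (1 / \<nu>) *\<^sub>R T i"
    using adm i prob_state_preimage[OF i] by (simp add: admissible_choice_def)
  have v: "(\<Sum>j<r ! i. ketbra (v i j) (v i j)) = Pr i"
    using adm i E by (intro projection_eq_sum_ketbra[symmetric] Pr_psd Pr_idem) (auto simp: admissible_choice_def)
  show ?thesis
    unfolding sum_ketbra_chi_vec \<psi> v matrix_eq
    by (simp add: scaleR_mult_vec mult_vec_scale T_Pr_vec[OF i] Pr_T_vec[OF i] vector_smult_assoc
        power2_eq_square flip: matrix_vector_mul_assoc)
qed

lemma R_map_preimage:
  assumes len: "length Q = length r"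
    and Q: "\<And>i. i < length r \<Longrightarrow> prob Q i *\<^sub>R state Q i = Z ** Pr i ** Z"
    and pos: "\<And>i. i < length r \<Longrightarrow> prob Q i > 0" and sum: "(\<Sum>i<length r. prob Q i) = 1"
    and tr: "\<And>i. i < length r \<Longrightarrow> trace (state Q i) = 1"
  shows "R_map r preimage_ensemble = Q"
proof -
  have chi: "chi_ensemble r \<psi> v = Q" if adm: "admissible_choice r preimage_ensemble E \<psi> v" for E \<psi> v
  proof (rule nth_equalityI)
    show "length (chi_ensemble r \<psi> v) = length Q" by (simp add: chi_ensemble_def len)
    have chi_sum: "(\<Sum>j<r ! i. ketbra (chi_vec r \<psi> v i j) (chi_vec r \<psi> v i j)) = (prob Q i / \<nu>\<^sup>2) *\<^sub>R state Q i"
      if "i < length r" for i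
      unfolding admissible_choice_chi[OF adm that] Q[OF that, symmetric] by simp
    have weight: "chi_weight r \<psi> v i = prob Q i / \<nu>\<^sup>2" if "i < length r" for i
    proof -
      have "chi_weight r \<psi> v i = Re (trace (\<Sum>j<r ! i. ketbra (chi_vec r \<psi> v i j) (chi_vec r \<psi> v i j)))"
        by (simp add: chi_weight_def trace_sum trace_ketbra)
      then show ?thesis
        unfolding chi_sum[OF that] by (simp add: trace_scaleR tr[OF that] del: of_real_divide)
    qed
    \<comment> \<open>The factor common to all weights cancels in the normalised probabilities,
      which leaves \<open>prob Q i\<close>.\<close>
    have total: "(\<Sum>l<length r. prob Q l / \<nu>\<^sup>2) = 1 / \<nu>\<^sup>2"
      by (simp add: sum flip: sum_divide_distrib)
    fix i assume "i < length (chi_ensemble r \<psi> v)"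
    then have i: "i < length r" by (simp add: chi_ensemble_def)
    show "chi_ensemble r \<psi> v ! i = Q ! i"
      using i pos[OF i] \<nu>_pos by (intro prod_eqI) (simp_all add: chi_ensemble_def total weight chi_sum)
  qed
  show ?thesis
    unfolding R_map_def
  proof (rule the_equality)
    show "\<exists>E \<psi> v. admissible_choice r preimage_ensemble E \<psi> v \<and> Q = chi_ensemble r \<psi> v"
      using admissible_choice_exists chi by metis
  qed (use chi in metis)
qed

end

section \<open>The pretty good measurement of a given ensemble\<close>

lemma ensemble_frame:
  fixes Q :: "'n::finite ensemble"
  assumes r: "\<forall>k\<in>set r. k \<ge> 1" "length r > 0" and Q: "Q \<in> ensembles r"
  obtains Z Y Pr w where "projective_measurement_frame r Z Y Pr w"
    "\<And>i. i < length r \<Longrightarrow> prob Q i *\<^sub>R state Q i = Z ** Pr i ** Z"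
proof -
  define B where "B i = prob Q i *\<^sub>R state Q i" for i
  have prob: "prob Q i > 0" and dens: "density_operator (state Q i)" and rank: "rank (state Q i) = r ! i"
    if "i < length r" for i
    using Q that by (auto simp: ensembles_def)
  have ind: "independent_subspaces (length r) (\<lambda>i. supp (state Q i))"
    and span: "vec.span (\<Union>i<length r. supp (state Q i)) = UNIV"
    using Q by (auto simp: ensembles_def)
  have B_psd: "psd (B i)" if "i < length r" for i
    using prob[OF that] dens[OF that] by (simp add: B_def psd_scaleR density_operator_def)
  have supp_B: "supp (B i) = supp (state Q i)" if "i < length r" for i
    using prob[OF that] by (simp add: B_def supp_scaleR)
  define S where "S = (\<Sum>i<length r. B i)"
  have S_psd: "psd S" unfolding S_def by (rule psd_sum) (simp add: B_psd)
  \<comment> \<open>A vector in the kernel of the sum is in the kernel of each positive semidefinite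
    summand, hence orthogonal to all supports, and these span the space.\<close>
  have S_inj: "x = 0" if Sx: "S *v x = 0" for x
  proof -
    have "(\<Sum>i<length r. Re (cinner x (B i *v x))) = Re (cinner x (S *v x))"
      by (simp add: S_def sum_mult_vec cinner_sum_right)
    then have "(\<Sum>i<length r. Re (cinner x (B i *v x))) = 0"
      using Sx by simp
    then have "Re (cinner x (B i *v x)) = 0" if "i < length r" for i
      using that psd_Re_nonneg[OF B_psd] by (subst (asm) sum_nonneg_eq_0_iff) auto
    then have "B i *v x = 0" if "i < length r" for i
      using psd_cinner[OF B_psd[OF that], of x] that
      by (intro psd_form_zero_imp[OF B_psd[OF that]]) (metis of_real_0)
    then have "cinner x v = 0" if "i < length r" "v \<in> supp (B i)" for v i
      using that by (simp add: supp_def)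
    then have "cinner x v = 0" if "v \<in> (\<Union>i<length r. supp (state Q i))" for v
      using that supp_B by blast
    then have "cinner x x = 0"
      by (rule orthogonal_span[of "\<Union>i<length r. supp (state Q i)"]) (simp_all add: span)
    then show ?thesis by simp
  qed
  obtain Z Y where Z: "psd Z" and ZY: "Z ** Y = mat 1" and YZ: "Y ** Z = mat 1" and ZZ: "Z ** Z = S"
    using psd_sqrt[OF S_psd S_inj] by blast
  have ZYv [simp]: "Z *v (Y *v x) = x" for x by (simp add: matrix_vector_mul_assoc ZY)
  have YZv [simp]: "Y *v (Z *v x) = x" for x by (simp add: matrix_vector_mul_assoc YZ)
  have Y_self: "cinner x (Y *v y) = cinner (Y *v x) y" for x y
    using psd_selfadjoint[OF Z, of "Y *v x" "Y *v y"] by simp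
  define Pr where "Pr i = Y ** B i ** Y" for i
  have Pr_vec: "Pr i *v x = Y *v (B i *v (Y *v x))" for i x
    by (simp add: Pr_def flip: matrix_vector_mul_assoc)
  have B_eq: "B i = Z ** Pr i ** Z" for i
    by (simp add: matrix_eq Pr_vec flip: matrix_vector_mul_assoc)
  have Pr_psd: "psd (Pr i)" if "i < length r" for i
    using B_psd[OF that] by (simp add: psd_iff_cinner Pr_vec Y_self)
  have Pr_sum_vec: "(\<Sum>i<length r. Pr i *v x) = x" for x
  proof -
    have "(\<Sum>i<length r. Pr i *v x) = Y *v (S *v (Y *v x))"
      by (simp add: Pr_vec S_def sum_mult_vec mult_vec_sum)
    then show ?thesis by (simp add: ZZ[symmetric] flip: matrix_vector_mul_assoc)
  qed
  have Pr_mult: "Pr j ** Pr i = (if j = i then Pr i else 0)" if i: "i < length r" and j: "j < length r" for i j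
    unfolding matrix_eq
  proof
    fix x
    \<comment> \<open>\<open>Pr i *v x\<close> is a sum of vectors from the ranges of the
      \<open>Pr k\<close> in two ways: as the sum of all \<open>Pr k *v (Pr i *v x)\<close>, and as
      itself in position \<open>i\<close>. The vectors \<open>v k\<close> are the differences of
      these decompositions, moved by \<open>Z\<close> into the supports of Q, where independence
      makes each of them zero.\<close>
    define u where "u k = Pr i *v x - (if k = i then x else 0)" for k
    define v where "v k = B k *v (Y *v u k)" for k
    have Yv: "Y *v v k = Pr k *v (Pr i *v x) - (if k = i then Pr i *v x else 0)" for k
      by (auto simp: v_def u_def Pr_vec matrix_vector_mult_diff_distrib)
    have "Y *v (\<Sum>k<length r. v k) = 0"
      using i by (simp add: mult_vec_sum Yv sum_subtractf Pr_sum_vec)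
    then have "(\<Sum>k<length r. v k) = 0" by (metis ZYv matrix_vector_mult_0_right)
    moreover have "v k \<in> supp (state Q k)" if "k < length r" for k
      using psd_range_supp[OF B_psd[OF that]] supp_B[OF that] by (simp add: v_def)
    ultimately have "v j = 0" using ind j unfolding independent_subspaces_def by blast
    then have "Pr j *v (Pr i *v x) = (if j = i then Pr i *v x else 0)"
      using Yv[of j] by simp
    then show "(Pr j ** Pr i) *v x = (if j = i then Pr i else 0) *v x"
      by (simp add: matrix_vector_mul_assoc)
  qed
  have dim: "vec.dim (supp (Pr i)) = r ! i" if "i < length r" for i
  proof -
    \<comment> \<open>The kernel of \<open>Pr i\<close> is the image under \<open>Z\<close> of the
      kernel of \<open>B i\<close>; passing to orthogonal complements turns \<open>Z\<close> into
      its inverse, and injectivity of \<open>Y\<close> preserves the dimension.\<close>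
    have "supp (Pr i) = (*v) Y ` supp (B i)"
    proof (intro equalityI subsetI)
      fix x assume x: "x \<in> supp (Pr i)"
      have "cinner y (Z *v x) = 0" if "B i *v y = 0" for y
      proof -
        have "Pr i *v (Z *v y) = 0" by (simp add: Pr_vec that)
        then have "cinner (Z *v y) x = 0" using x by (simp add: supp_def)
        then show ?thesis by (simp only: psd_selfadjoint[OF Z])
      qed
      then have "Z *v x \<in> supp (B i)" by (simp add: supp_def)
      then show "x \<in> (*v) Y ` supp (B i)" by (metis YZv imageI)
    next
      fix x assume "x \<in> (*v) Y ` supp (B i)"
      then obtain z where z: "z \<in> supp (B i)" "x = Y *v z" by blast
      have "cinner y x = 0" if "Pr i *v y = 0" for y
      proof -
        have "Z *v (Pr i *v y) = 0" by (simp add: that)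
        then have "B i *v (Y *v y) = 0" by (simp add: Pr_vec)
        then have "cinner (Y *v y) z = 0" using z by (simp add: supp_def)
        then show ?thesis by (simp add: z(2) Y_self)
      qed
      then show "x \<in> supp (Pr i)" by (simp add: supp_def)
    qed
    moreover have "inj ((*v) Y)" by (metis ZYv injI)
    then have "vec.dim ((*v) Y ` supp (B i)) = vec.dim (supp (B i))"
      by (intro vec.dim_image_eq[OF matrix_vector_mul_linear_gen]) (auto intro: inj_on_subset)
    ultimately show ?thesis
      using rank[OF that] supp_B[OF that] by (simp add: rank_eq_dim_supp)
  qed
  have "\<exists>w. orthonormal_basis_of (r ! i) w (supp (Pr i)) \<and>
      (\<forall>j<r ! i. \<forall>k<r ! i. j \<noteq> k \<longrightarrow> cinner (w j) (Z *v w k) = 0)" if "i < length r" for i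
    using orthonormal_form_diagonalising_basis[of Z "supp (Pr i)", OF psd_selfadjoint[OF Z] subspace_supp]
    unfolding dim[OF that] .
  then obtain w where w: "\<And>i. i < length r \<Longrightarrow> orthonormal_basis_of (r ! i) (w i) (supp (Pr i)) \<and>
      (\<forall>j<r ! i. \<forall>k<r ! i. j \<noteq> k \<longrightarrow> cinner (w i j) (Z *v w i k) = 0)"
    by metis
  have "projective_measurement_frame r Z Y Pr w"
  proof
    show "r ! i > 0" if "i < length r" for i
      using r(1) that by (metis nth_mem less_le_trans zero_less_one)
    show "(\<Sum>i<length r. Pr i) = mat 1"
      by (simp add: matrix_eq sum_mult_vec Pr_sum_vec)
    show "Pr i ** Pr j = (if i = j then Pr i else 0)" if "i < length r" "j < length r" for i j
      using Pr_mult[OF that(2,1)] by auto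
  qed (use r Z ZY YZ Pr_psd w in auto)
  then show ?thesis
    using that B_eq by (simp add: B_def)
qed

theorem theorem3p2p1:
  fixes r :: "nat list"
  assumes "sorted_wrt (\<ge>) r"
    and "\<forall>k\<in>set r. k \<ge> 1"
    and "sum_list r = CARD('n::finite)"
  shows "\<forall>Q \<in> (ensembles r :: 'n ensemble set). \<exists>P \<in> ensembles r. R_map r P = Q"
proof
  fix Q :: "'n ensemble"
  assume Q: "Q \<in> ensembles r"
  have nonempty: "length r > 0" using assms(3) by (cases r) auto
  obtain Z Y Pr w where "projective_measurement_frame r Z Y Pr w"
    and Z: "\<And>i. i < length r \<Longrightarrow> prob Q i *\<^sub>R state Q i = Z ** Pr i ** Z"
    using ensemble_frame[OF assms(2) nonempty Q] by blast
  then interpret projective_measurement_frame r Z Y Pr w by simp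
  have Q_props: "length Q = length r" "(\<Sum>i<length r. prob Q i) = 1"
      "independent_subspaces (length r) (\<lambda>i. supp (state Q i))"
      "vec.span (\<Union>i<length r. supp (state Q i)) = UNIV"
    using Q by (simp_all add: ensembles_def)
  have Q_nth: "prob Q i > 0" "trace (state Q i) = 1" "rank (state Q i) = r ! i"
      if "i < length r" for i
    using Q that by (auto simp: ensembles_def density_operator_def)
  have supp: "supp (Z ** Pr i ** Z) = supp (state Q i)" if "i < length r" for i
    using Q_nth(1)[OF that] by (simp add: supp_scaleR flip: Z[OF that])
  have "preimage_ensemble \<in> ensembles r"
  proof (rule preimage_in_ensembles)
    show "vec.dim (supp (Z ** Pr i ** Z)) = r ! i" if "i < length r" for i
      using Q_nth(3)[OF that] by (simp add: supp[OF that] rank_eq_dim_supp)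
    show "independent_subspaces (length r) (\<lambda>i. supp (Z ** Pr i ** Z))"
      by (rule iffD2[OF independent_subspaces_cong Q_props(3)]) (rule supp)
    show "vec.span (\<Union>i<length r. supp (Z ** Pr i ** Z)) = UNIV"
      using Q_props(4) by (simp add: supp)
  qed
  moreover have "R_map r preimage_ensemble = Q"
    using Q_props(1,2) Q_nth(1,2) Z by (intro R_map_preimage) auto
  ultimately show "\<exists>P\<in>ensembles r. R_map r P = Q" by blast
qed

end
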